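(* Let $T$ be a rooted, countably infinite and locally finite tree. Assume that $T$ is homogeneous by sectors at the level $N$. Let $B:\mathcal{L}\to\mathcal{L}$ be the backward shift and let $\Gamma''=\max\{\gamma(v): |v|=1\}$. Then $\|B\|\ge\Gamma''+2\gamma(o)-2$.
   Context: A tree is an undirected graph (no loops or multiple edges) in which any two vertices are joined by exactly one path; $T$ also denotes its vertex set. It is locally finite if every vertex has finite degree. $T$ has a distinguished vertex $o$, the root; $|v|$ is the length (number of edges) of the path from $o$ to $v$. For $v\neq o$, the parent $\mathrm{par}(v)$ is the vertex preceding $v$ on the unique path from $o$ to $v$; $\mathrm{Chi}(v)$ is the set of children of $v$ (vertices with parent $v$), and $\gamma(v)$ is its cardinality. The sector $S_v$ is the set consisting of $v$ and all its descendants. $T$ is homogeneous by sectors at the level $N\in\{0,1,2,\dots\}$ if for all $v\in T$ with $|v|=N$ we have $\gamma(w)=\gamma(v)$ for each $w\in S_v$. For $f:T\to\mathbb{C}$ define $f'(o)=f(o)$ and $f'(v)=f(v)-f(\mathrm{par}(v))$ for $v\neq o$. The Lipschitz space $\mathcal{L}$ is the Banach space of all $f:T\to\mathbb{C}$ with $f'$ bounded, with norm $\|f\|=\sup_{v\in T}|f'(v)|$. The backward shift is $(Bf)(v)=\sum_{w\in\mathrm{Chi}(v)}f(w)$ (empty sum equal to $0$); it is bounded on $\mathcal{L}$ when $T$ is homogeneous by sectors. *)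

theory Defs
  imports "HOL-Analysis.Analysis"
begin

text \<open>
  A graph is given by its adjacency relation \<open>E\<close>; its vertex set is the whole type \<open>'v\<close>.
  The root is written \<open>r\<close>.
\<close>

definition is_path :: "('v \<Rightarrow> 'v \<Rightarrow> bool) \<Rightarrow> 'v \<Rightarrow> 'v list \<Rightarrow> 'v \<Rightarrow> bool" where
  "is_path E u p v \<longleftrightarrow>
     p \<noteq> [] \<and> hd p = u \<and> last p = v \<and> distinct p \<and> successively E p"

definition is_tree :: "('v \<Rightarrow> 'v \<Rightarrow> bool) \<Rightarrow> bool" where
  "is_tree E \<longleftrightarrow> symp E \<and> irreflp E \<and> (\<forall>u v. \<exists>!p. is_path E u p v)"

definition locally_finite_graph :: "('v \<Rightarrow> 'v \<Rightarrow> bool) \<Rightarrow> bool" where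
  "locally_finite_graph E \<longleftrightarrow> (\<forall>v. finite {w. E v w})"

definition root_path :: "('v \<Rightarrow> 'v \<Rightarrow> bool) \<Rightarrow> 'v \<Rightarrow> 'v \<Rightarrow> 'v list" where
  "root_path E r v = (THE p. is_path E r p v)"

definition level :: "('v \<Rightarrow> 'v \<Rightarrow> bool) \<Rightarrow> 'v \<Rightarrow> 'v \<Rightarrow> nat" where
  "level E r v = length (root_path E r v) - 1"

text \<open>The parent is only meaningful for \<open>v \<noteq> r\<close>; every use below is guarded accordingly.\<close>

definition par :: "('v \<Rightarrow> 'v \<Rightarrow> bool) \<Rightarrow> 'v \<Rightarrow> 'v \<Rightarrow> 'v" where
  "par E r v = last (butlast (root_path E r v))"

definition Chi :: "('v \<Rightarrow> 'v \<Rightarrow> bool) \<Rightarrow> 'v \<Rightarrow> 'v \<Rightarrow> 'v set" where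
  "Chi E r v = {w. w \<noteq> r \<and> par E r w = v}"

definition num_children :: "('v \<Rightarrow> 'v \<Rightarrow> bool) \<Rightarrow> 'v \<Rightarrow> 'v \<Rightarrow> nat" where
  "num_children E r v = card (Chi E r v)"

definition sector :: "('v \<Rightarrow> 'v \<Rightarrow> bool) \<Rightarrow> 'v \<Rightarrow> 'v \<Rightarrow> 'v set" where
  "sector E r v = {w. (v, w) \<in> {(x, y). y \<in> Chi E r x}\<^sup>*}"

definition homogeneous_by_sectors :: "('v \<Rightarrow> 'v \<Rightarrow> bool) \<Rightarrow> 'v \<Rightarrow> nat \<Rightarrow> bool" where
  "homogeneous_by_sectors E r N \<longleftrightarrow>
     (\<forall>v. level E r v = N \<longrightarrow>
        (\<forall>w \<in> sector E r v. num_children E r w = num_children E r v))"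

definition tree_deriv ::
    "('v \<Rightarrow> 'v \<Rightarrow> bool) \<Rightarrow> 'v \<Rightarrow> ('v \<Rightarrow> complex) \<Rightarrow> 'v \<Rightarrow> complex" where
  "tree_deriv E r f v = (if v = r then f r else f v - f (par E r v))"

definition Lip :: "('v \<Rightarrow> 'v \<Rightarrow> bool) \<Rightarrow> 'v \<Rightarrow> ('v \<Rightarrow> complex) set" where
  "Lip E r = {f. bounded (range (tree_deriv E r f))}"

definition Lip_norm :: "('v \<Rightarrow> 'v \<Rightarrow> bool) \<Rightarrow> 'v \<Rightarrow> ('v \<Rightarrow> complex) \<Rightarrow> real" where
  "Lip_norm E r f = (SUP v. cmod (tree_deriv E r f v))"

text \<open>
  Both \<open>Lip_norm\<close> and \<open>Lip_opnorm\<close> are real suprema, hence meaningful only for functions in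
  \<open>Lip\<close> and for linear operators that map \<open>Lip\<close> boundedly into itself. The library's
  \<open>onorm\<close> does not apply because \<open>Lip\<close> is a set depending on the tree rather than a type.
\<close>

definition Lip_opnorm ::
    "('v \<Rightarrow> 'v \<Rightarrow> bool) \<Rightarrow> 'v \<Rightarrow> (('v \<Rightarrow> complex) \<Rightarrow> ('v \<Rightarrow> complex)) \<Rightarrow> real" where
  "Lip_opnorm E r A = (SUP f \<in> {f \<in> Lip E r. Lip_norm E r f \<le> 1}. Lip_norm E r (A f))"

definition backward_shift ::
    "('v \<Rightarrow> 'v \<Rightarrow> bool) \<Rightarrow> 'v \<Rightarrow> ('v \<Rightarrow> complex) \<Rightarrow> 'v \<Rightarrow> complex" where
  "backward_shift E r f v = (\<Sum>w \<in> Chi E r v. f w)"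

end

theory Submission
  imports Defs
begin

text \<open>
  Write \<open>B\<close> for the backward shift and \<open>\<gamma>(v)\<close> for the number of children of \<open>v\<close>. The lower bound
  comes from a single test function. Choose a child \<open>v\<close> of the root \<open>r\<close> for which \<open>\<gamma>(v)\<close> is maximal.
  The derivative of \<open>B f\<close> at \<open>v\<close> is the sum of \<open>f\<close> over the children of \<open>v\<close> minus its sum over the
  children of the root. So \<open>f\<close> should increase along \<open>v\<close> and its children and decrease towards
  the siblings of \<open>v\<close>. Starting from \<open>f(r) = -1\<close>, steps of size one give \<open>f(v) = 0\<close>, \<open>f = 1\<close> on the
  children of \<open>v\<close> and \<open>f = -2\<close> on the siblings of \<open>v\<close>; continuing \<open>f\<close> without further change
  away from the root keeps its norm at most one. Hence
  \<open>(B f)'(v) = \<gamma>(v) - (0 - 2 (\<gamma>(r) - 1)) = \<gamma>(v) + 2 \<gamma>(r) - 2\<close>.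

  This value bounds the operator norm from below only if the suprema that define the norms are
  suprema of bounded sets, that is, if \<open>B\<close> is bounded (lemma \<open>backward_shift_deriv_bound\<close>). The
  reason is that for \<open>f\<close> of norm at most one, \<open>B f\<close> differs from \<open>\<gamma> \<cdot> f\<close> by at most \<open>\<gamma>\<close>
  (lemma \<open>backward_shift_near_multiple\<close>). Homogeneity by sectors and local finiteness bound \<open>\<gamma>\<close>.
  At levels greater than \<open>N\<close>, \<open>\<gamma>\<close> takes the same value at a vertex and its parent, so that
  \<open>\<gamma> \<cdot> f\<close> has a bounded derivative there. At levels up to \<open>N\<close>, the function \<open>f\<close> itself is
  bounded, because \<open>\<bar>f(v)\<bar>\<close> is at most one more than the level of \<open>v\<close>.
\<close>

section \<open>Parents and levels\<close>

context
  fixes E :: "'v \<Rightarrow> 'v \<Rightarrow> bool" and r :: 'v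
  assumes tree: "is_tree E"
begin

lemma is_path_root_path: "is_path E r (root_path E r v) v"
  using tree theI'[of "\<lambda>p. is_path E r p v"]
  unfolding is_tree_def root_path_def by blast

lemma root_path_eqI: "is_path E r p v \<Longrightarrow> root_path E r v = p"
  using tree is_path_root_path unfolding is_tree_def by blast

lemma level_root: "level E r r = 0"
proof -
  have "is_path E r [r] r"
    by (simp add: is_path_def)
  then show ?thesis
    by (simp add: level_def root_path_eqI)
qed

text \<open>
  Removing the last vertex of the root path of \<open>v\<close> leaves a path from the root to the parent of
  \<open>v\<close>, which by uniqueness of paths is the root path of the parent.
\<close>

lemma
  assumes "v \<noteq> r"
  shows level_nonroot: "level E r v = Suc (level E r (par E r v))"
    and edge_par: "E (par E r v) v"
proof -
  define p where "p = root_path E r v"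
  have p: "p \<noteq> []" "hd p = r" "last p = v" "distinct p" "successively E p"
    using is_path_root_path[of v] by (auto simp: is_path_def p_def)
  define q where "q = butlast p"
  have pq: "p = q @ [v]"
    using p append_butlast_last_id[of p] by (simp add: q_def)
  have q: "q \<noteq> []"
    using p pq assms by auto
  have par: "par E r v = last q"
    by (simp add: par_def q_def p_def)
  have "is_path E r q (last q)"
    using p q unfolding pq by (auto simp: is_path_def successively_append_iff)
  then have "root_path E r (par E r v) = q"
    by (simp add: par root_path_eqI)
  then show "level E r v = Suc (level E r (par E r v))"
    using pq q by (simp add: level_def p_def[symmetric])
  show "E (par E r v) v"
    using p q unfolding pq par by (simp add: successively_append_iff)
qed

lemma level_eq_0_iff: "level E r v = 0 \<longleftrightarrow> v = r"
  using level_root level_nonroot[of v] by (cases "v = r") auto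

lemma level_Chi: "w \<in> Chi E r v \<Longrightarrow> level E r w = Suc (level E r v)"
  using level_nonroot[of w] by (auto simp: Chi_def)

lemma level_eq_1: "{v. level E r v = 1} = Chi E r r"
proof -
  have "v \<in> Chi E r r" if "level E r v = 1" for v
    using that level_root level_nonroot[of v] level_eq_0_iff[of "par E r v"]
    by (cases "v = r") (auto simp: Chi_def)
  moreover have "level E r v = 1" if "v \<in> Chi E r r" for v
    using level_Chi[OF that] by (simp add: level_root)
  ultimately show ?thesis
    by blast
qed

lemma finite_Chi:
  assumes "locally_finite_graph E"
  shows "finite (Chi E r v)"
proof (rule finite_subset)
  show "Chi E r v \<subseteq> {w. E v w}"
    using edge_par by (auto simp: Chi_def)
  show "finite {w. E v w}"
    using assms by (simp add: locally_finite_graph_def)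
qed

lemma finite_level_le:
  assumes "locally_finite_graph E"
  shows "finite {v. level E r v \<le> n}"
proof (induction n)
  case 0
  then show ?case
    by (simp add: level_eq_0_iff)
next
  case (Suc n)
  have "{v. level E r v \<le> Suc n} \<subseteq> insert r (\<Union>u\<in>{u. level E r u \<le> n}. Chi E r u)"
  proof
    fix v
    assume "v \<in> {v. level E r v \<le> Suc n}"
    then show "v \<in> insert r (\<Union>u\<in>{u. level E r u \<le> n}. Chi E r u)"
      using level_nonroot[of v] by (cases "v = r") (auto simp: Chi_def)
  qed
  moreover have "finite (insert r (\<Union>u\<in>{u. level E r u \<le> n}. Chi E r u))"
    using Suc finite_Chi[OF assms] by blast
  ultimately show ?case
    by (rule finite_subset)
qed

text \<open>
  Following parents upwards from any other vertex, the last step before the root is a child of the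
  root. So a root without children would be the only vertex.
\<close>

lemma Chi_root_nonempty:
  assumes "infinite (UNIV :: 'v set)"
  shows "Chi E r r \<noteq> {}"
proof
  assume empty: "Chi E r r = {}"
  have "v = r" for v
  proof (induction "level E r v" arbitrary: v)
    case 0
    then show ?case
      using level_eq_0_iff[of v] by simp
  next
    case (Suc n)
    show ?case
    proof (rule ccontr)
      assume v: "v \<noteq> r"
      then have "par E r v = r"
        using Suc level_nonroot[OF v] by simp
      with v have "v \<in> Chi E r r"
        by (simp add: Chi_def)
      with empty show False
        by simp
    qed
  qed
  then have "(UNIV :: 'v set) \<subseteq> {r}"
    by blast
  then show False
    using assms finite_subset by blast
qed

section \<open>Sectors and the number of children\<close>

lemma in_sector_of_level:
  assumes "N \<le> level E r w"
  obtains v where "level E r v = N" "w \<in> sector E r v"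
proof -
  have "\<exists>v. level E r v = N \<and> w \<in> sector E r v"
    using assms
  proof (induction "level E r w" arbitrary: w)
    case 0
    then show ?case
      by (auto simp: sector_def)
  next
    case (Suc n)
    show ?case
    proof (cases "level E r w = N")
      case True
      then show ?thesis
        by (auto simp: sector_def)
    next
      case False
      have w: "w \<noteq> r"
        using Suc(2) level_root by auto
      then have "\<exists>v. level E r v = N \<and> par E r w \<in> sector E r v"
        using Suc False level_nonroot[OF w] by simp
      moreover have "w \<in> Chi E r (par E r w)"
        using w by (simp add: Chi_def)
      ultimately show ?thesis
        by (auto simp: sector_def intro: rtrancl_into_rtrancl)
    qed
  qed
  then show ?thesis
    using that by blast
qed

lemma num_children_par:
  assumes "homogeneous_by_sectors E r N" and "N < level E r w"
  shows "num_children E r (par E r w) = num_children E r w"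
proof -
  have "w \<noteq> r"
    using assms(2) level_root by auto
  then have "N \<le> level E r (par E r w)"
    using assms(2) level_nonroot[of w] by simp
  then obtain v where v: "level E r v = N" "par E r w \<in> sector E r v"
    by (rule in_sector_of_level)
  then have "w \<in> sector E r v"
    using \<open>w \<noteq> r\<close> by (auto simp: sector_def Chi_def intro: rtrancl_into_rtrancl)
  then show ?thesis
    using v assms(1) by (simp add: homogeneous_by_sectors_def)
qed

text \<open>
  Homogeneity reduces the values of the number of children to those at levels up to \<open>N\<close>, and there
  are only finitely many vertices at these levels.
\<close>

lemma num_children_bounded:
  assumes "homogeneous_by_sectors E r N" and "locally_finite_graph E"
  obtains K where "\<And>v. num_children E r v \<le> K"
proof -
  let ?A = "{v. level E r v \<le> N}"
  define K where "K = Max (num_children E r ` ?A)"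
  have low: "num_children E r v \<le> K" if "level E r v \<le> N" for v
    unfolding K_def using that finite_level_le[OF assms(2)] by (intro Max_ge) auto
  have "num_children E r w \<le> K" for w
  proof (cases "level E r w \<le> N")
    case False
    then obtain v where "level E r v = N" "w \<in> sector E r v"
      using in_sector_of_level by (metis nat_le_linear)
    then show ?thesis
      using assms(1) low[of v] by (simp add: homogeneous_by_sectors_def)
  qed (rule low)
  then show ?thesis
    by (rule that)
qed

section \<open>Boundedness of the backward shift\<close>

lemma norm_le_level:
  assumes "\<And>v. cmod (tree_deriv E r f v) \<le> 1"
  shows "cmod (f v) \<le> real (level E r v) + 1"
proof (induction "level E r v" arbitrary: v)
  case 0
  then show ?case
    using assms[of r] level_eq_0_iff[of v] by (simp add: tree_deriv_def)
next
  case (Suc n)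
  then have v: "v \<noteq> r"
    using level_root by auto
  then have "cmod (f (par E r v)) \<le> real n + 1"
    using Suc level_nonroot[of v] by fastforce
  moreover have "cmod (f v - f (par E r v)) \<le> 1"
    using assms[of v] v by (simp add: tree_deriv_def)
  ultimately show ?case
    using norm_triangle_sub[of "f v" "f (par E r v)"] Suc(2) by linarith
qed

text \<open>The difference is the sum of the derivatives of \<open>f\<close> over the children of \<open>v\<close>.\<close>

lemma backward_shift_near_multiple:
  assumes "\<And>v. cmod (tree_deriv E r f v) \<le> 1"
  shows "cmod (backward_shift E r f v - of_nat (num_children E r v) * f v)
           \<le> real (num_children E r v)"
proof -
  have "backward_shift E r f v - of_nat (num_children E r v) * f v
          = (\<Sum>w\<in>Chi E r v. f w - f v)"
    by (simp add: backward_shift_def num_children_def sum_subtractf)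
  also have "\<dots> = (\<Sum>w\<in>Chi E r v. tree_deriv E r f w)"
    by (rule sum.cong) (auto simp: tree_deriv_def Chi_def)
  also have "cmod \<dots> \<le> real (card (Chi E r v)) * 1"
    using assms by (intro sum_norm_bound)
  finally show ?thesis
    by (simp add: num_children_def)
qed

lemma backward_shift_le_level:
  assumes f: "\<And>v. cmod (tree_deriv E r f v) \<le> 1"
    and K: "num_children E r v \<le> K"
  shows "cmod (backward_shift E r f v) \<le> real K * (real (level E r v) + 2)"
proof -
  let ?c = "real (num_children E r v)" and ?l = "real (level E r v)"
  have "cmod (backward_shift E r f v)
          \<le> cmod (of_nat (num_children E r v) * f v)
            + cmod (backward_shift E r f v - of_nat (num_children E r v) * f v)"
    by (rule norm_triangle_sub)
  also have "\<dots> \<le> ?c * (?l + 1) + ?c"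
    using backward_shift_near_multiple[OF f, of v] norm_le_level[OF f, of v]
    by (intro add_mono) (simp_all add: norm_mult mult_left_mono)
  also have "\<dots> = ?c * (?l + 2)"
    by (simp add: algebra_simps)
  also have "\<dots> \<le> real K * (?l + 2)"
    using K by (intro mult_right_mono) auto
  finally show ?thesis .
qed

text \<open>
  At levels up to \<open>N\<close> both terms of the derivative are estimated separately, by
  \<open>backward_shift_le_level\<close>. At greater levels, \<open>v\<close> and its parent have the same number \<open>c\<close> of children,
  and passing from \<open>B f\<close> to \<open>c \<cdot> f\<close> at both vertices gives three terms of size at most \<open>c\<close>.
\<close>

lemma backward_shift_deriv_bound:
  assumes hom: "homogeneous_by_sectors E r N"
    and K: "\<And>v. num_children E r v \<le> K"
    and f: "\<And>v. cmod (tree_deriv E r f v) \<le> 1"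
  shows "cmod (tree_deriv E r (backward_shift E r f) v) \<le> real K * (2 * real N + 3)"
proof -
  let ?B = "backward_shift E r f" and ?p = "par E r v"
  consider (root) "v = r" | (low) "v \<noteq> r" "level E r v \<le> N" | (deep) "v \<noteq> r" "N < level E r v"
    by linarith
  then show ?thesis
  proof cases
    case root
    have "cmod (?B r) \<le> real K * 2"
      using backward_shift_le_level[OF f K, of r] by (simp add: level_root)
    also have "\<dots> \<le> real K * (2 * real N + 3)"
      by (intro mult_left_mono) auto
    finally show ?thesis
      using root by (simp add: tree_deriv_def)
  next
    case low
    have "cmod (?B v - ?B ?p) \<le> cmod (?B v) + cmod (?B ?p)"
      by (rule norm_triangle_ineq4)
    also have "\<dots> \<le> real K * (real (level E r v) + 2) + real K * (real (level E r ?p) + 2)"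
      by (intro add_mono backward_shift_le_level f K)
    also have "\<dots> = real K * (2 * real (level E r v) + 3)"
      using level_nonroot[OF low(1)] by (simp add: algebra_simps)
    also have "\<dots> \<le> real K * (2 * real N + 3)"
      using low by (intro mult_left_mono) auto
    finally show ?thesis
      using low by (simp add: tree_deriv_def)
  next
    case deep
    define c where "c = num_children E r v"
    have cp: "num_children E r ?p = c"
      using num_children_par[OF hom deep(2)] by (simp add: c_def)
    let ?x = "?B v - of_nat c * f v" and ?y = "of_nat c * (f v - f ?p)"
      and ?z = "?B ?p - of_nat c * f ?p"
    have x: "cmod ?x \<le> real c"
      using backward_shift_near_multiple[OF f, of v] by (simp add: c_def)
    have y: "cmod ?y \<le> real c"
      using f[of v] deep by (simp add: tree_deriv_def norm_mult mult_left_le)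
    have z: "cmod ?z \<le> real c"
      using backward_shift_near_multiple[OF f, of ?p] by (simp add: cp)
    have "?B v - ?B ?p = ?x + ?y - ?z"
      by (simp add: algebra_simps)
    then have "cmod (?B v - ?B ?p) = cmod (?x + ?y - ?z)"
      by (simp only:)
    also have "\<dots> \<le> real c * 3"
      using norm_triangle_ineq4[of "?x + ?y" ?z] norm_triangle_ineq[of ?x ?y] x y z by linarith
    also have "\<dots> \<le> real K * (2 * real N + 3)"
      using K[of v] by (intro mult_mono) (auto simp: c_def)
    finally show ?thesis
      using deep by (simp add: tree_deriv_def)
  qed
qed

end

section \<open>Norms as suprema\<close>

lemma norm_tree_deriv_le_Lip_norm:
  assumes "f \<in> Lip E r"
  shows "cmod (tree_deriv E r f v) \<le> Lip_norm E r f"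
proof -
  have "bdd_above (range (\<lambda>v. cmod (tree_deriv E r f v)))"
    using assms by (auto simp: Lip_def bounded_iff bdd_above_def)
  then show ?thesis
    unfolding Lip_norm_def by (intro cSUP_upper) auto
qed

lemma LipI:
  assumes "\<And>v. cmod (tree_deriv E r f v) \<le> C"
  shows "f \<in> Lip E r" and "Lip_norm E r f \<le> C"
  using assms by (auto simp: Lip_def bounded_iff Lip_norm_def intro!: cSUP_least)

text \<open>
  A uniform bound \<open>C\<close> on the image of the unit ball makes the supremum in \<open>Lip_opnorm\<close> one of a
  set that is bounded above.
\<close>

lemma norm_tree_deriv_le_Lip_opnorm:
  assumes bound: "\<And>g v. (\<And>w. cmod (tree_deriv E r g w) \<le> 1) \<Longrightarrow> cmod (tree_deriv E r (A g) v) \<le> C"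
    and f: "\<And>w. cmod (tree_deriv E r f w) \<le> 1"
  shows "cmod (tree_deriv E r (A f) v) \<le> Lip_opnorm E r A"
proof -
  let ?U = "{f \<in> Lip E r. Lip_norm E r f \<le> 1}"
  have "Lip_norm E r (A g) \<le> C" if "g \<in> ?U" for g
    using that by (intro LipI(2) bound) (auto intro: order_trans norm_tree_deriv_le_Lip_norm)
  then have "bdd_above ((\<lambda>g. Lip_norm E r (A g)) ` ?U)"
    by (auto simp: bdd_above_def)
  moreover have "f \<in> ?U"
    using LipI[OF f] by simp
  ultimately have "Lip_norm E r (A f) \<le> Lip_opnorm E r A"
    unfolding Lip_opnorm_def by (intro cSUP_upper)
  moreover have "A f \<in> Lip E r"
    using bound[OF f] by (rule LipI(1))
  ultimately show ?thesis
    by (intro order_trans[OF norm_tree_deriv_le_Lip_norm])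
qed

section \<open>The test function\<close>

definition sector_test :: "('v \<Rightarrow> 'v \<Rightarrow> bool) \<Rightarrow> 'v \<Rightarrow> 'v \<Rightarrow> 'v \<Rightarrow> complex" where
  "sector_test E r v w =
     (if w = r then -1 else if w = v then 0 else if w \<in> sector E r v then 1 else -2)"

lemma par_in_sector:
  assumes "w \<in> sector E r v" and "w \<noteq> v"
  shows "w \<noteq> r" and "par E r w \<in> sector E r v"
proof -
  have "(v, w) \<in> {(x, y). y \<in> Chi E r x}\<^sup>*"
    using assms(1) by (simp add: sector_def)
  then have "w \<noteq> r \<and> par E r w \<in> sector E r v"
    using assms(2) by cases (auto simp: sector_def Chi_def)
  then show "w \<noteq> r" and "par E r w \<in> sector E r v"
    by blast+
qed

lemma root_notin_sector: "v \<noteq> r \<Longrightarrow> r \<notin> sector E r v"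
  using par_in_sector(1) by metis

lemma par_in_sector_iff:
  assumes "w \<noteq> r" and "w \<noteq> v"
  shows "par E r w \<in> sector E r v \<longleftrightarrow> w \<in> sector E r v"
proof
  show "w \<in> sector E r v" if "par E r w \<in> sector E r v"
    using that assms(1) by (auto simp: sector_def Chi_def intro: rtrancl_into_rtrancl)
  show "par E r w \<in> sector E r v" if "w \<in> sector E r v"
    using that assms(2) by (rule par_in_sector(2))
qed

text \<open>
  A vertex other than \<open>r\<close> and \<open>v\<close> lies in the sector of \<open>v\<close> exactly when its parent does, so
  the value changes only along the edges at \<open>r\<close> and at \<open>v\<close>, and there by one.
\<close>

lemma tree_deriv_sector_test:
  assumes "v \<in> Chi E r r"
  shows "cmod (tree_deriv E r (sector_test E r v) w) \<le> 1"
proof -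
  have v: "v \<noteq> r" "par E r v = r"
    using assms by (auto simp: Chi_def)
  have "v \<in> sector E r v"
    by (simp add: sector_def)
  then show ?thesis
    using v root_notin_sector[OF v(1), of E] par_in_sector_iff[of w r v E]
    by (cases "w = r"; cases "w = v") (auto simp: tree_deriv_def sector_test_def)
qed

lemma backward_shift_sector_test:
  assumes v: "v \<in> Chi E r r" and fin: "finite (Chi E r r)"
  shows "tree_deriv E r (backward_shift E r (sector_test E r v)) v
           = of_real (real (num_children E r v) + 2 * real (num_children E r r) - 2)"
proof -
  let ?f = "sector_test E r v"
  have nr: "v \<noteq> r" "par E r v = r"
    using v by (auto simp: Chi_def)
  have "?f w = 1" if "w \<in> Chi E r v" for w
    using that nr by (auto simp: sector_test_def sector_def Chi_def)
  then have at_v: "backward_shift E r ?f v = of_nat (num_children E r v)"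
    by (simp add: backward_shift_def num_children_def)
  have "?f u = -2" if "u \<in> Chi E r r - {v}" for u
    using that root_notin_sector[OF nr(1), of E] par_in_sector_iff[of u r v E]
    by (auto simp: sector_test_def Chi_def)
  then have "(\<Sum>u\<in>Chi E r r - {v}. ?f u) = -2 * of_nat (card (Chi E r r - {v}))"
    by simp
  moreover have "?f v = 0"
    using nr by (simp add: sector_test_def)
  ultimately have "backward_shift E r ?f r = -2 * of_nat (card (Chi E r r - {v}))"
    using sum.remove[OF fin v, of ?f] by (simp add: backward_shift_def)
  moreover have "card (Chi E r r) = Suc (card (Chi E r r - {v}))"
    by (rule card.remove[OF fin v])
  ultimately show ?thesis
    using at_v nr by (simp add: tree_deriv_def num_children_def)
qed

section \<open>The lower bound\<close>

theorem proposition4p12: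
  fixes E :: "'v \<Rightarrow> 'v \<Rightarrow> bool" and r :: 'v and N :: nat
  assumes "is_tree E"
    and "countable (UNIV :: 'v set)" and "infinite (UNIV :: 'v set)"
    and "locally_finite_graph E"
    and "homogeneous_by_sectors E r N"
  shows "Lip_opnorm E r (backward_shift E r)
           \<ge> real (Max (num_children E r ` {v. level E r v = 1}))
              + 2 * real (num_children E r r) - 2"
proof -
  note tree = assms(1) and inf = assms(3) and lf = assms(4) and hom = assms(5)
  have fin: "finite (Chi E r r)"
    by (rule finite_Chi[OF tree lf])
  have "Max (num_children E r ` Chi E r r) \<in> num_children E r ` Chi E r r"
    using fin Chi_root_nonempty[OF tree inf] by (intro Max_in) auto
  then obtain v where v: "v \<in> Chi E r r"
      and max: "Max (num_children E r ` Chi E r r) = num_children E r v"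
    by auto
  obtain K where K: "\<And>w. num_children E r w \<le> K"
    using num_children_bounded[OF tree hom lf] by blast
  let ?d = "real (num_children E r v) + 2 * real (num_children E r r) - 2"
  have "?d \<le> cmod (of_real ?d)"
    unfolding norm_of_real by (rule abs_ge_self)
  also have "\<dots> = cmod (tree_deriv E r (backward_shift E r (sector_test E r v)) v)"
    by (simp only: backward_shift_sector_test[OF v fin])
  also have "\<dots> \<le> Lip_opnorm E r (backward_shift E r)"
    using backward_shift_deriv_bound[OF tree hom K] tree_deriv_sector_test[OF v]
    by (rule norm_tree_deriv_le_Lip_opnorm)
  finally show ?thesis
    by (simp only: level_eq_1[OF tree] max)
qed

end
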